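(* The function $(1^n)\mapsto\#\mathrm{Par}(n)$ is in $\#\mathsf{L}$.
   Context: $\mathrm{Par}(n)$ is the set of integer partitions of $n$. The alphabet is $\Sigma=\{0,1\}$; $1^n$ is the string of $n$ ones. A function given only on strings of a displayed form is extended by $0$ to all other strings. $\#\mathsf{L}$ is the class of functions $f:\Sigma^*\to\mathbb{N}_0$ such that $f(x)$ is the number of accepting computation paths on input $x$ of a fixed nondeterministic Turing machine with read-only input tape that uses $O(\log|x|)$ work space and halts on every computation path. Equivalently: there are a polynomial $q$ and a deterministic $O(\log|x|)$-space Turing machine $M$ with an additional read-once, left-to-right witness tape such that $f(x)=\#\{w\in\Sigma^{q(|x|)}\mid M(x,w)=\mathsf{yes}\}$. *)

theory Defs
  imports Complex_Main "HOL-Library.Multiset" "HOL-Library.Landau_Symbols"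
begin

definition Par :: "nat \<Rightarrow> nat multiset set" where
  "Par n = {P. 0 \<notin># P \<and> \<Sum>\<^sub># P = n}"

text \<open>Strings over the alphabet {0,1} are boolean lists, with True for the letter 1.\<close>

definition on_unary :: "(nat \<Rightarrow> nat) \<Rightarrow> bool list \<Rightarrow> nat" where
  "on_unary g w = (if w = replicate (length w) True then g (length w) else 0)"

datatype isym = LeftEnd | Letter bool | RightEnd

datatype dir = MoveLeft | Stay | MoveRight

fun move :: "dir \<Rightarrow> int \<Rightarrow> int" where
  "move MoveLeft i = i - 1"
| "move Stay i = i"
| "move MoveRight i = i + 1"

text \<open>An instruction \<open>(q, a, s, q', s', d, e)\<close> may be executed in state \<open>q\<close> when the input head
  reads \<open>a\<close> and the work head reads \<open>s\<close>; it enters state \<open>q'\<close>, writes \<open>s'\<close> to the work tape,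
  moves the input head by \<open>d\<close> and the work head by \<open>e\<close>.\<close>

type_synonym ('q, 's) instr = "'q \<times> isym \<times> 's \<times> 'q \<times> 's \<times> dir \<times> dir"

record ('q, 's) ntm =
  start :: 'q
  accepting :: "'q set"
  blank :: 's
  instrs :: "('q, 's) instr set"

text \<open>Finiteness of the instruction set means that only finitely many states and work symbols
  are ever used. The input head is confined to the input word and its two end markers.\<close>

definition wf_ntm :: "('q, 's) ntm \<Rightarrow> bool" where
  "wf_ntm M \<longleftrightarrow> finite (instrs M) \<and>
     (\<forall>(q, a, s, q', s', d, e) \<in> instrs M.
        (a = LeftEnd \<longrightarrow> d \<noteq> MoveLeft) \<and> (a = RightEnd \<longrightarrow> d \<noteq> MoveRight))"

text \<open>The input word \<open>x\<close> occupies positions \<open>1, \<dots>, length x\<close>, between the markers at \<open>0\<close>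
  and \<open>length x + 1\<close>. The single work tape is infinite in both directions.\<close>

datatype ('q, 's) config =
  Config (state: 'q) (ihead: int) (work: "int \<Rightarrow> 's") (whead: int)

definition read_input :: "bool list \<Rightarrow> int \<Rightarrow> isym" where
  "read_input x i = (if i \<le> 0 then LeftEnd
     else if i \<le> int (length x) then Letter (x ! nat (i - 1)) else RightEnd)"

definition init_config :: "('q, 's) ntm \<Rightarrow> ('q, 's) config" where
  "init_config M = Config (start M) 0 (\<lambda>_. blank M) 0"

inductive step :: "('q, 's) ntm \<Rightarrow> bool list \<Rightarrow> ('q, 's) config \<Rightarrow> ('q, 's) config \<Rightarrow> bool"
  for M x where
  "(q, read_input x i, t j, q', s', d, e) \<in> instrs M \<Longrightarrow>
     step M x (Config q i t j) (Config q' (move d i) (t(j := s')) (move e j))"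

definition comp_path :: "('q, 's) ntm \<Rightarrow> bool list \<Rightarrow> ('q, 's) config list \<Rightarrow> bool" where
  "comp_path M x cs \<longleftrightarrow> cs \<noteq> [] \<and> hd cs = init_config M \<and> successively (step M x) cs"

text \<open>Distinct instructions applicable in a configuration lead to distinct configurations, so
  counting paths as sequences of configurations or of instructions makes no difference.\<close>

definition accepting_path :: "('q, 's) ntm \<Rightarrow> bool list \<Rightarrow> ('q, 's) config list \<Rightarrow> bool" where
  "accepting_path M x cs \<longleftrightarrow> comp_path M x cs \<and>
     (\<nexists>c. step M x (last cs) c) \<and> state (last cs) \<in> accepting M"

definition always_halts :: "('q, 's) ntm \<Rightarrow> bool list \<Rightarrow> bool" where
  "always_halts M x \<longleftrightarrow> \<not> (\<exists>c. c 0 = init_config M \<and> (\<forall>n::nat. step M x (c n) (c (Suc n))))"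

definition path_space :: "('q, 's) config list \<Rightarrow> nat" where
  "path_space cs = card (whead ` set cs)"

definition log_space :: "('q, 's) ntm \<Rightarrow> bool" where
  "log_space M \<longleftrightarrow> (\<exists>b :: nat \<Rightarrow> nat.
     (\<lambda>n. real (b n)) \<in> O(\<lambda>n. ln (real n)) \<and>
     (\<forall>x cs. comp_path M x cs \<longrightarrow> path_space cs \<le> b (length x)))"

text \<open>States and work symbols are numbered by natural numbers without loss of generality. By
  Koenig's lemma a well-formed machine that always halts has only finitely many paths on each
  input, so the cardinality below is never that of an infinite set.\<close>

definition sharpL :: "(bool list \<Rightarrow> nat) set" where
  "sharpL = {f. \<exists>M :: (nat, nat) ntm. wf_ntm M \<and> log_space M \<and> (\<forall>x. always_halts M x) \<and>
     (\<forall>x. f x = card {cs. accepting_path M x cs})}"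

end

theory Submission imports Defs begin

text \<open>The counting machine rests on the recurrence for the number \<open>p(k, r)\<close> of partitions of \<open>r\<close>
  into parts of size at most \<open>k\<close>: a partition of \<open>r > 0\<close> with parts at most \<open>k + 1\<close> either avoids
  the part \<open>k + 1\<close>, or is obtained by adding such a part to a partition of \<open>r - (k + 1)\<close>
  that also has parts at most \<open>k + 1\<close> (\<open>card_bounded_parts_Suc\<close>). A nondeterministic machine
  holding the pair \<open>(k, r)\<close> can follow this recurrence, branching once at each step, so that its accepting paths on \<open>(n + 1, n)\<close> correspond
  to the partitions of \<open>n\<close>.

  On input \<open>1\<^sup>n\<close> the position of the input head can store \<open>r\<close>, with \<open>r = 0\<close> recognised by the left
  end marker. Only \<open>k\<close> has to be written down, in binary, which takes logarithmically many cells;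
  the number written is \<open>\<kappa> = k - 1\<close>, and initially \<open>\<kappa> = n\<close>, obtained by counting the letters of
  the input. To replace \<open>r\<close> by \<open>r - (\<kappa> + 1)\<close> without losing \<open>\<kappa>\<close>, each cell holds a bit of
  \<open>\<kappa>\<close> and a bit of a second counter, which equals \<open>\<kappa>\<close> at the start: the input head moves left once,
  and once more each time the second counter is decremented, until a decrement fails. If the input
  head would have to leave the left end, the path rejects. All counter operations are deterministic
  sweeps over the digits.

  Acceptance count, space and termination are verified together: \<open>comp_tree M x W c m\<close> states that
  the computation tree below \<open>c\<close> is finite, keeps the work head inside \<open>W\<close>, and has \<open>m\<close>
  accepting leaves. Such statements are derived backwards along the runs of the machine, the
  branching being handled in \<open>run_choose\<close>.\<close>

section \<open>Finite computation trees\<close>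

text \<open>\<open>comp_tree M x W c m\<close>: on input \<open>x\<close> the computation tree of \<open>M\<close> below \<open>c\<close> is finite, the work
  head stays within the cells \<open>W\<close>, and exactly \<open>m\<close> of the leaves are accepting.\<close>

inductive comp_tree ::
  "('q, 's) ntm \<Rightarrow> bool list \<Rightarrow> int set \<Rightarrow> ('q, 's) config \<Rightarrow> nat \<Rightarrow> bool"
  for M x W where
  halt: "\<lbrakk>whead c \<in> W; \<nexists>c'. step M x c c'\<rbrakk> \<Longrightarrow>
     comp_tree M x W c (if state c \<in> accepting M then 1 else 0)"
| branch: "\<lbrakk>whead c \<in> W; {c'. step M x c c'} = S; finite S; S \<noteq> {};
     \<And>c'. c' \<in> S \<Longrightarrow> comp_tree M x W c' (f c')\<rbrakk> \<Longrightarrow>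
     comp_tree M x W c (\<Sum>c'\<in>S. f c')"

lemma comp_tree_halts:
  assumes "comp_tree M x W c m"
  shows "\<not> (\<exists>s. s 0 = c \<and> (\<forall>n::nat. step M x (s n) (s (Suc n))))"
  using assms
proof induction
  case (halt c)
  then show ?case by metis
next
  case (branch c S f)
  show ?case
  proof
    assume "\<exists>s. s 0 = c \<and> (\<forall>n::nat. step M x (s n) (s (Suc n)))"
    then obtain s where s: "s 0 = c" "\<And>n::nat. step M x (s n) (s (Suc n))" by blast
    then have "s (Suc 0) \<in> S" using branch.hyps(2) by auto
    moreover have "\<exists>s'. s' 0 = s (Suc 0) \<and> (\<forall>n::nat. step M x (s' n) (s' (Suc n)))"
      using s by (intro exI[of _ "\<lambda>n. s (Suc n)"]) auto
    ultimately show False using branch.IH by blast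
  qed
qed

lemma comp_tree_space:
  assumes "comp_tree M x W c m" "cs \<noteq> []" "hd cs = c" "successively (step M x) cs"
  shows "whead ` set cs \<subseteq> W"
  using assms
proof (induction arbitrary: cs)
  case (halt c)
  then obtain cs' where "cs = c # cs'" by (cases cs) auto
  with halt show ?case by (cases cs') auto
next
  case (branch c S f)
  then obtain cs' where cs: "cs = c # cs'" by (cases cs) auto
  show ?case
  proof (cases "cs' = []")
    case False
    then have "step M x c (hd cs')" "successively (step M x) cs'"
      using branch.prems cs by (auto simp: successively_Cons)
    then have "whead ` set cs' \<subseteq> W"
      using branch.IH[of "hd cs'" cs'] branch.hyps(2) False by blast
    then show ?thesis using cs branch.hyps(1) by simp
  qed (use cs branch.hyps(1) in simp)
qed

text \<open>The accepting paths from an arbitrary configuration \<open>c\<close>, as lists beginning with \<open>c\<close>.\<close>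

definition accepting_from :: "('q, 's) ntm \<Rightarrow> bool list \<Rightarrow> ('q, 's) config \<Rightarrow> ('q, 's) config list set" where
  "accepting_from M x c = {cs. cs \<noteq> [] \<and> hd cs = c \<and> successively (step M x) cs \<and>
     (\<nexists>c'. step M x (last cs) c') \<and> state (last cs) \<in> accepting M}"

lemma accepting_from_halt:
  assumes "\<nexists>c'. step M x c c'"
  shows "accepting_from M x c = (if state c \<in> accepting M then {[c]} else {})"
proof -
  have "cs = [c]" if acc: "cs \<in> accepting_from M x c" for cs
  proof -
    obtain cs' where cs: "cs = c # cs'"
      using acc by (cases cs) (auto simp: accepting_from_def)
    then show ?thesis using acc assms by (cases cs') (auto simp: accepting_from_def)
  qed
  moreover have "[c] \<in> accepting_from M x c \<longleftrightarrow> state c \<in> accepting M"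
    using assms by (simp add: accepting_from_def)
  ultimately show ?thesis by auto
qed

lemma accepting_from_branch:
  assumes "{c'. step M x c c'} = S" "S \<noteq> {}"
  shows "accepting_from M x c = (\<Union>c'\<in>S. (#) c ` accepting_from M x c')"
proof (intro set_eqI iffI)
  fix cs assume cs: "cs \<in> accepting_from M x c"
  then obtain cs' where eq: "cs = c # cs'" by (cases cs) (auto simp: accepting_from_def)
  have "cs' \<noteq> []" using cs eq assms by (auto simp: accepting_from_def)
  then have "hd cs' \<in> S" "cs' \<in> accepting_from M x (hd cs')"
    using cs eq assms(1) by (auto simp: accepting_from_def successively_Cons)
  then show "cs \<in> (\<Union>c'\<in>S. (#) c ` accepting_from M x c')" using eq by blast
next
  fix cs assume "cs \<in> (\<Union>c'\<in>S. (#) c ` accepting_from M x c')"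
  then show "cs \<in> accepting_from M x c"
    using assms(1) by (auto simp: accepting_from_def successively_Cons)
qed

lemma comp_tree_card:
  assumes "comp_tree M x W c m"
  shows "finite (accepting_from M x c) \<and> card (accepting_from M x c) = m"
  using assms
proof induction
  case (halt c)
  then show ?case by (simp add: accepting_from_halt)
next
  case (branch c S f)
  note eq = accepting_from_branch[OF branch.hyps(2,4)]
  have disj: "(#) c ` accepting_from M x c1 \<inter> (#) c ` accepting_from M x c2 = {}"
    if "c1 \<noteq> c2" for c1 c2
    using that by (auto simp: accepting_from_def)
  have "card (\<Union>c'\<in>S. (#) c ` accepting_from M x c')
      = (\<Sum>c'\<in>S. card ((#) c ` accepting_from M x c'))"
    using branch.hyps(3) branch.IH disj by (intro card_UN_disjoint) auto
  also have "\<dots> = (\<Sum>c'\<in>S. f c')"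
    using branch.IH by (intro sum.cong) (auto simp: card_image)
  finally show ?case using eq branch.hyps(3) branch.IH by auto
qed

text \<open>It suffices to exhibit, for every input, a computation tree confined to a logarithmic window of
  cells.\<close>

lemma sharpL_I:
  fixes M :: "(nat, nat) ntm" and b :: "nat \<Rightarrow> nat"
  assumes "wf_ntm M"
    and "(\<lambda>n. real (b n)) \<in> O(\<lambda>n. ln (real n))"
    and tree: "\<And>x. comp_tree M x {0..<int (b (length x))} (init_config M) (f x)"
  shows "f \<in> sharpL"
proof -
  have "path_space cs \<le> b (length x)" if "comp_path M x cs" for x cs
  proof -
    have "whead ` set cs \<subseteq> {0..<int (b (length x))}"
      using comp_tree_space[OF tree] that unfolding comp_path_def by blast
    then have "path_space cs \<le> card {0..<int (b (length x))}"
      unfolding path_space_def by (intro card_mono) auto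
    then show ?thesis by simp
  qed
  then have "log_space M" using assms(2) unfolding log_space_def by blast
  moreover have "always_halts M x" for x
    using comp_tree_halts[OF tree] unfolding always_halts_def .
  moreover have "f x = card {cs. accepting_path M x cs}" for x
    using comp_tree_card[OF tree, of x]
    by (simp add: accepting_from_def accepting_path_def comp_path_def conj_assoc)
  ultimately show ?thesis using assms(1) unfolding sharpL_def by blast
qed

text \<open>The possible actions in state \<open>q\<close> when the heads read \<open>a\<close> and \<open>s\<close>. The tree lemmas below refer to
  these rather than to successor configurations. In \<open>comp_tree_choice\<close> the two new states differ, so
  the two successors do as well.\<close>

definition moves :: "('q, 's) ntm \<Rightarrow> 'q \<Rightarrow> isym \<Rightarrow> 's \<Rightarrow> ('q \<times> 's \<times> dir \<times> dir) set" where
  "moves M q a s = {r. (q, a, s, r) \<in> instrs M}"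

lemma step_iff_moves:
  "step M x (Config q i t j) c \<longleftrightarrow> (\<exists>q' s' d e. (q', s', d, e) \<in> moves M q (read_input x i) (t j) \<and>
     c = Config q' (move d i) (t(j := s')) (move e j))"
  by (simp add: moves_def step.simps) metis

lemma comp_tree_halt:
  assumes "j \<in> W" "moves M q (read_input x i) (t j) = {}"
    and "m = (if q \<in> accepting M then 1 else 0)"
  shows "comp_tree M x W (Config q i t j) m"
  using halt[of "Config q i t j" W M x] assms by (simp add: step_iff_moves)

lemma comp_tree_step:
  assumes "j \<in> W" "moves M q (read_input x i) (t j) = {(q', s', d, e)}"
    and "comp_tree M x W (Config q' (move d i) (t(j := s')) (move e j)) m"
  shows "comp_tree M x W (Config q i t j) m"
  using branch[of "Config q i t j" W M x "{Config q' (move d i) (t(j := s')) (move e j)}" "\<lambda>_. m"]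
    assms by (simp add: step_iff_moves)

lemma comp_tree_choice:
  assumes "j \<in> W"
    and "moves M q (read_input x i) (t j) = {(q1, s1, d1, e1), (q2, s2, d2, e2)}"
    and "q1 \<noteq> q2"
    and "comp_tree M x W (Config q1 (move d1 i) (t(j := s1)) (move e1 j)) m1"
    and "comp_tree M x W (Config q2 (move d2 i) (t(j := s2)) (move e2 j)) m2"
  shows "comp_tree M x W (Config q i t j) (m1 + m2)"
proof -
  let ?c1 = "Config q1 (move d1 i) (t(j := s1)) (move e1 j)"
  let ?c2 = "Config q2 (move d2 i) (t(j := s2)) (move e2 j)"
  have "{c'. step M x (Config q i t j) c'} = {?c1, ?c2}"
    using assms(2) by (auto simp: step_iff_moves)
  then have "comp_tree M x W (Config q i t j) (\<Sum>c\<in>{?c1, ?c2}. if c = ?c1 then m1 else m2)"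
    using assms by (intro branch) auto
  then show ?thesis using assms(3) by simp
qed

section \<open>Partitions with bounded parts\<close>

text \<open>Partitions of \<open>r\<close> with all parts at most \<open>k\<close>.\<close>

definition bounded_parts :: "nat \<Rightarrow> nat \<Rightarrow> nat multiset set" where
  "bounded_parts k r = {P \<in> Par r. \<forall>p\<in>#P. p \<le> k}"

lemma bounded_parts_0_right: "bounded_parts k 0 = {{#}}"
proof -
  have "P = {#}" if "P \<in> bounded_parts k 0" for P
  proof (cases P)
    case (add p Q)
    then show ?thesis using that by (auto simp: bounded_parts_def Par_def)
  qed simp
  moreover have "{#} \<in> bounded_parts k 0" by (simp add: bounded_parts_def Par_def)
  ultimately show ?thesis by blast
qed

lemma bounded_parts_0_left:
  assumes "r > 0"
  shows "bounded_parts 0 r = {}"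
proof -
  have False if "P \<in> bounded_parts 0 r" for P
  proof (cases P)
    case empty
    then show ?thesis using that assms by (simp add: bounded_parts_def Par_def)
  next
    case (add p Q)
    then show ?thesis using that by (auto simp: bounded_parts_def Par_def)
  qed
  then show ?thesis by blast
qed

lemma bounded_parts_eq_Par:
  assumes "r \<le> k"
  shows "bounded_parts k r = Par r"
proof -
  have "p \<le> k" if "P \<in> Par r" "p \<in># P" for P p
  proof -
    have "p \<le> \<Sum>\<^sub># P" using \<open>p \<in># P\<close> by (metis sum_mset.remove le_add1)
    then show ?thesis using that assms by (simp add: Par_def)
  qed
  then show ?thesis by (auto simp: bounded_parts_def)
qed

lemma bounded_parts_Suc:
  "bounded_parts (Suc k) r = bounded_parts k r \<union>
     (if Suc k \<le> r then add_mset (Suc k) ` bounded_parts (Suc k) (r - Suc k) else {})"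
proof (intro set_eqI iffI)
  fix P assume P: "P \<in> bounded_parts (Suc k) r"
  show "P \<in> bounded_parts k r \<union>
     (if Suc k \<le> r then add_mset (Suc k) ` bounded_parts (Suc k) (r - Suc k) else {})"
  proof (cases "Suc k \<in># P")
    case True
    then obtain Q where "P = add_mset (Suc k) Q" by (meson multi_member_split)
    then show ?thesis using P by (auto simp: bounded_parts_def Par_def)
  next
    case False
    then show ?thesis using P by (auto simp: bounded_parts_def Par_def le_Suc_eq)
  qed
next
  fix P assume "P \<in> bounded_parts k r \<union>
     (if Suc k \<le> r then add_mset (Suc k) ` bounded_parts (Suc k) (r - Suc k) else {})"
  then show "P \<in> bounded_parts (Suc k) r"
    by (auto simp: bounded_parts_def Par_def split: if_splits)
qed

lemma finite_bounded_parts: "finite (bounded_parts k r)"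
proof (induction "k + r" arbitrary: k r rule: less_induct)
  case less
  show ?case
  proof (cases k)
    case 0
    then show ?thesis using bounded_parts_0_left[of r] bounded_parts_0_right[of 0]
      by (cases "r = 0") auto
  next
    case (Suc k')
    have "finite (bounded_parts k' r)" using less[of k' r] Suc by simp
    moreover have "finite (bounded_parts (Suc k') (r - Suc k'))" if "Suc k' \<le> r"
      using less[of "Suc k'" "r - Suc k'"] that Suc by simp
    ultimately show ?thesis unfolding Suc bounded_parts_Suc[of k' r] by auto
  qed
qed

lemma card_bounded_parts_Suc:
  "card (bounded_parts (Suc k) r) = card (bounded_parts k r) +
     (if Suc k \<le> r then card (bounded_parts (Suc k) (r - Suc k)) else 0)"
proof (cases "Suc k \<le> r")
  case True
  have "bounded_parts k r \<inter> add_mset (Suc k) ` bounded_parts (Suc k) (r - Suc k) = {}"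
    by (auto simp: bounded_parts_def)
  then have "card (bounded_parts (Suc k) r) = card (bounded_parts k r) +
      card (add_mset (Suc k) ` bounded_parts (Suc k) (r - Suc k))"
    using True by (simp add: bounded_parts_Suc[of k r] card_Un_disjoint finite_bounded_parts)
  then show ?thesis using True by (simp add: card_image inj_on_def)
next
  case False
  then show ?thesis by (simp add: bounded_parts_Suc[of k r])
qed

section \<open>A machine for the partition recurrence\<close>

text \<open>A cell in use holds two bits, one for each counter: \<open>fst\<close> belongs to \<open>\<kappa>\<close> and \<open>snd\<close> to the second
  counter. They are coded by the symbols \<open>1, \<dots>, 4\<close>; the blank is \<open>0\<close>.\<close>

definition sym_of :: "bool \<times> bool \<Rightarrow> nat" where
  "sym_of p = 1 + 2 * of_bool (fst p) + of_bool (snd p)"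

lemma sym_eq_iff [simp]: "sym_of p = sym_of p' \<longleftrightarrow> p = p'"
  by (cases p; cases p') (auto simp: sym_of_def of_bool_def)

lemma sym_neq_0 [simp]: "sym_of p \<noteq> 0" "0 \<noteq> sym_of p"
  by (simp_all add: sym_of_def)

text \<open>The states. Their numbering starts at \<open>2\<close> so that no state is turned into \<open>0\<close> or \<open>Suc 0\<close> by
  simplification.

  \<^item> \<open>Scan\<close> moves over the input, starting \<open>Inc\<close> at each letter 1 and ending in \<open>Choose\<close>. It
    halts at a letter 0.
  \<^item> \<open>Inc\<close> and \<open>IncBack\<close> increment both counters and return.
  \<^item> \<open>Choose\<close> is the only state with two options, to start \<open>Dec\<close> or to start \<open>Sub\<close>. It is the
    accepting state, but is halting only when the input head has reached the left end.
  \<^item> \<open>Dec\<close> decrements both counters, and halts if they are zero.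
  \<^item> \<open>Sub\<close> decrements the second counter. On success \<open>SubBack\<close> returns, moves the input head left
    and repeats; on failure control passes to \<open>Restore\<close>.
  \<^item> \<open>Restore\<close> returns while copying the first counter to the second, and enters \<open>Choose\<close>.\<close>

abbreviation (input) "Scan \<equiv> 2 :: nat"
abbreviation (input) "Inc \<equiv> 3 :: nat"
abbreviation (input) "IncBack \<equiv> 4 :: nat"
abbreviation (input) "Choose \<equiv> 5 :: nat"
abbreviation (input) "Dec \<equiv> 6 :: nat"
abbreviation (input) "Sub \<equiv> 7 :: nat"
abbreviation (input) "SubBack \<equiv> 8 :: nat"
abbreviation (input) "Restore \<equiv> 9 :: nat"

text \<open>Instructions executed on the digits, or on the blank just beyond the last one, together with the
  return of \<open>Restore\<close> to the home cell. The input head rests, on a letter 1 or, during a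
  subtraction, possibly on the left end marker. Digits are read least significant first, so that
  carries and borrows travel to the right. The parameters are the input symbol \<open>a\<close> and the two bits
  of a cell; \<open>par_ntm\<close> unites the instructions over the values that can occur.\<close>

definition sweep_instrs :: "isym \<Rightarrow> bool \<Rightarrow> bool \<Rightarrow> (nat, nat) instr set" where
  "sweep_instrs a b t = {
     (Inc, a, sym_of (True, True), Inc, sym_of (False, False), Stay, MoveRight),
     (Inc, a, sym_of (False, False), IncBack, sym_of (True, True), Stay, MoveLeft),
     (Inc, a, 0, IncBack, sym_of (True, True), Stay, MoveLeft),
     (IncBack, a, sym_of (b, t), IncBack, sym_of (b, t), Stay, MoveLeft),
     (Dec, a, sym_of (False, False), Dec, sym_of (True, True), Stay, MoveRight),
     (Dec, a, sym_of (True, True), Restore, sym_of (False, False), Stay, MoveLeft),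
     (Sub, a, sym_of (b, False), Sub, sym_of (b, True), Stay, MoveRight),
     (Sub, a, sym_of (b, True), SubBack, sym_of (b, False), Stay, MoveLeft),
     (Sub, a, 0, Restore, 0, Stay, MoveLeft),
     (SubBack, a, sym_of (b, t), SubBack, sym_of (b, t), Stay, MoveLeft),
     (Restore, a, sym_of (b, t), Restore, sym_of (b, b), Stay, MoveLeft),
     (Restore, a, 0, Choose, 0, Stay, Stay)}"

text \<open>The remaining instructions executed on the home cell, a blank cell directly before the digits.
  Without an instruction for \<open>SubBack\<close> at the left end marker, subtracting more than \<open>r\<close> leads to a
  halt in a rejecting state.\<close>

definition home_instrs :: "(nat, nat) instr set" where
  "home_instrs = {
     (Scan, LeftEnd, 0, Scan, 0, MoveRight, Stay),
     (Scan, Letter True, 0, Inc, 0, Stay, MoveRight),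
     (Scan, RightEnd, 0, Choose, 0, MoveLeft, Stay),
     (IncBack, Letter True, 0, Scan, 0, MoveRight, Stay),
     (Choose, Letter True, 0, Dec, 0, Stay, MoveRight),
     (Choose, Letter True, 0, Sub, 0, MoveLeft, MoveRight),
     (SubBack, Letter True, 0, Sub, 0, MoveLeft, MoveRight)}"

definition par_ntm :: "(nat, nat) ntm" where
  "par_ntm = \<lparr>start = Scan, accepting = {Choose}, blank = 0,
     instrs = home_instrs \<union> (\<Union>a\<in>{LeftEnd, Letter True}. \<Union>b. \<Union>t. sweep_instrs a b t)\<rparr>"

lemma wf_par_ntm: "wf_ntm par_ntm"
proof -
  have "finite (instrs par_ntm)"
    by (simp add: par_ntm_def home_instrs_def sweep_instrs_def)
  then show ?thesis
    unfolding wf_ntm_def by (auto simp: par_ntm_def home_instrs_def sweep_instrs_def)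
qed

lemmas instr_defs = moves_def par_ntm_def home_instrs_def sweep_instrs_def

lemma moves_home:
  "moves par_ntm Scan LeftEnd 0 = {(Scan, 0, MoveRight, Stay)}"
  "moves par_ntm Scan (Letter True) 0 = {(Inc, 0, Stay, MoveRight)}"
  "moves par_ntm Scan (Letter False) 0 = {}"
  "moves par_ntm Scan RightEnd 0 = {(Choose, 0, MoveLeft, Stay)}"
  "moves par_ntm IncBack (Letter True) 0 = {(Scan, 0, MoveRight, Stay)}"
  "moves par_ntm Choose (Letter True) 0 = {(Dec, 0, Stay, MoveRight), (Sub, 0, MoveLeft, MoveRight)}"
  "moves par_ntm Choose LeftEnd 0 = {}"
  "moves par_ntm SubBack (Letter True) 0 = {(Sub, 0, MoveLeft, MoveRight)}"
  "moves par_ntm SubBack LeftEnd 0 = {}"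
  by (auto simp: instr_defs)

lemma moves_sweep:
  assumes "a \<in> {LeftEnd, Letter True}"
  shows
  "moves par_ntm Inc a (sym_of (True, True)) = {(Inc, sym_of (False, False), Stay, MoveRight)}"
  "moves par_ntm Inc a (sym_of (False, False)) = {(IncBack, sym_of (True, True), Stay, MoveLeft)}"
  "moves par_ntm Inc a 0 = {(IncBack, sym_of (True, True), Stay, MoveLeft)}"
  "moves par_ntm IncBack a (sym_of p) = {(IncBack, sym_of p, Stay, MoveLeft)}"
  "moves par_ntm Dec a (sym_of (False, False)) = {(Dec, sym_of (True, True), Stay, MoveRight)}"
  "moves par_ntm Dec a (sym_of (True, True)) = {(Restore, sym_of (False, False), Stay, MoveLeft)}"
  "moves par_ntm Dec a 0 = {}"
  "moves par_ntm Sub a (sym_of (b, False)) = {(Sub, sym_of (b, True), Stay, MoveRight)}"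
  "moves par_ntm Sub a (sym_of (b, True)) = {(SubBack, sym_of (b, False), Stay, MoveLeft)}"
  "moves par_ntm Sub a 0 = {(Restore, 0, Stay, MoveLeft)}"
  "moves par_ntm SubBack a (sym_of p) = {(SubBack, sym_of p, Stay, MoveLeft)}"
  "moves par_ntm Restore a (sym_of p) = {(Restore, sym_of (fst p, fst p), Stay, MoveLeft)}"
  "moves par_ntm Restore a 0 = {(Choose, 0, Stay, Stay)}"
  using assms by (cases p; auto simp: instr_defs)+

section \<open>Configurations as digit lists with a cursor\<close>

text \<open>The tape with the digits \<open>ps\<close> in the cells \<open>1, \<dots>, length ps\<close>; the home cell is \<open>0\<close>.\<close>

definition tape :: "(bool \<times> bool) list \<Rightarrow> int \<Rightarrow> nat" where
  "tape ps j = (if 1 \<le> j \<and> j \<le> int (length ps) then sym_of (ps ! nat (j - 1)) else 0)"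

text \<open>Configurations with the work head on the home cell (\<open>home\<close>); on the first cell of \<open>rs\<close>, or on the
  blank after the digits if \<open>rs\<close> is empty (\<open>inside\<close>); one cell further left (\<open>left_of\<close>). The
  list \<open>ls\<close> holds the digits before \<open>rs\<close> in reverse order, nearest first.\<close>

definition home :: "nat \<Rightarrow> int \<Rightarrow> (bool \<times> bool) list \<Rightarrow> (nat, nat) config" where
  "home q i ps = Config q i (tape ps) 0"

definition inside :: "nat \<Rightarrow> int \<Rightarrow> (bool \<times> bool) list \<Rightarrow> (bool \<times> bool) list \<Rightarrow> (nat, nat) config" where
  "inside q i ls rs = Config q i (tape (rev ls @ rs)) (1 + int (length ls))"

definition left_of :: "nat \<Rightarrow> int \<Rightarrow> (bool \<times> bool) list \<Rightarrow> (bool \<times> bool) list \<Rightarrow> (nat, nat) config" where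
  "left_of q i ls rs = Config q i (tape (rev ls @ rs)) (int (length ls))"

lemma tape_0 [simp]: "tape ps 0 = 0"
  by (simp add: tape_def)

lemma tape_head [simp]:
  "tape (rev ls @ p # rs) (1 + int (length ls)) = sym_of p"
  "tape (rev ls) (1 + int (length ls)) = 0"
  by (auto simp: tape_def nth_append)

lemma tape_upd_0 [simp]: "(tape ps)(0 := 0) = tape ps"
  by auto

lemma tape_upd [simp]:
  "(tape (rev ls @ p # rs))(1 + int (length ls) := sym_of p') = tape (rev ls @ p' # rs)"
  "(tape (rev ls))(1 + int (length ls) := sym_of p') = tape (rev ls @ [p'])"
  "(tape (rev ls))(1 + int (length ls) := 0) = tape (rev ls)"
  by (auto simp: tape_def nth_append nth_Cons' fun_eq_iff)

text \<open>Computation trees of the machine in which the work head stays on the cells \<open>0, \<dots>, B - 1\<close>.\<close>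

abbreviation par_tree :: "bool list \<Rightarrow> nat \<Rightarrow> (nat, nat) config \<Rightarrow> nat \<Rightarrow> bool" where
  "par_tree x B \<equiv> comp_tree par_ntm x {0..<int B}"

lemma left_of_simps:
  "left_of q i [] rs = home q i rs"
  "left_of q i (p # ls) rs = inside q i ls (p # rs)"
  by (simp_all add: left_of_def home_def inside_def)

lemma inside_halt:
  assumes "moves par_ntm q (read_input x i) 0 = {}" "q \<noteq> Choose" "length ls + 1 < B"
  shows "par_tree x B (inside q i ls []) 0"
  unfolding inside_def
proof (rule comp_tree_halt)
  show "1 + int (length ls) \<in> {0..<int B}" using assms(3) by simp
  show "moves par_ntm q (read_input x i) (tape (rev ls @ []) (1 + int (length ls))) = {}"
    using assms(1) by simp
  show "0 = (if q \<in> accepting par_ntm then 1 else 0 :: nat)"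
    using assms(2) by (simp add: par_ntm_def)
qed

lemma inside_right:
  assumes "moves par_ntm q (read_input x i) (sym_of p) = {(q', sym_of p', Stay, MoveRight)}"
    and "par_tree x B (inside q' i (p' # ls) rs) m" "length ls + 1 < B"
  shows "par_tree x B (inside q i ls (p # rs)) m"
  unfolding inside_def
proof (rule comp_tree_step)
  show "1 + int (length ls) \<in> {0..<int B}" using assms(3) by simp
  show "moves par_ntm q (read_input x i) (tape (rev ls @ p # rs) (1 + int (length ls)))
      = {(q', sym_of p', Stay, MoveRight)}"
    using assms(1) by simp
  have "1 + int (length (p' # ls)) = move MoveRight (1 + int (length ls))" by simp
  then show "par_tree x B (Config q' (move Stay i)
      ((tape (rev ls @ p # rs))(1 + int (length ls) := sym_of p')) (move MoveRight (1 + int (length ls)))) m"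
    using assms(2) unfolding inside_def tape_upd by simp
qed

lemma inside_left:
  assumes "moves par_ntm q (read_input x i) (sym_of p) = {(q', sym_of p', Stay, MoveLeft)}"
    and "par_tree x B (left_of q' i ls (p' # rs)) m" "length ls + 1 < B"
  shows "par_tree x B (inside q i ls (p # rs)) m"
  unfolding inside_def
proof (rule comp_tree_step)
  show "1 + int (length ls) \<in> {0..<int B}" using assms(3) by simp
  show "moves par_ntm q (read_input x i) (tape (rev ls @ p # rs) (1 + int (length ls)))
      = {(q', sym_of p', Stay, MoveLeft)}"
    using assms(1) by simp
  show "par_tree x B (Config q' (move Stay i)
      ((tape (rev ls @ p # rs))(1 + int (length ls) := sym_of p')) (move MoveLeft (1 + int (length ls)))) m"
    using assms(2) unfolding left_of_def tape_upd by simp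
qed

lemma inside_left_extend:
  assumes "moves par_ntm q (read_input x i) 0 = {(q', sym_of p', Stay, MoveLeft)}"
    and "par_tree x B (left_of q' i ls [p']) m" "length ls + 1 < B"
  shows "par_tree x B (inside q i ls []) m"
  unfolding inside_def append_Nil2
proof (rule comp_tree_step)
  show "1 + int (length ls) \<in> {0..<int B}" using assms(3) by simp
  show "moves par_ntm q (read_input x i) (tape (rev ls) (1 + int (length ls)))
      = {(q', sym_of p', Stay, MoveLeft)}"
    using assms(1) by simp
  show "par_tree x B (Config q' (move Stay i)
      ((tape (rev ls))(1 + int (length ls) := sym_of p')) (move MoveLeft (1 + int (length ls)))) m"
    using assms(2) unfolding left_of_def tape_upd by simp
qed

lemma inside_left_end:
  assumes "moves par_ntm q (read_input x i) 0 = {(q', 0, Stay, MoveLeft)}"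
    and "par_tree x B (left_of q' i ls []) m" "length ls + 1 < B"
  shows "par_tree x B (inside q i ls []) m"
  unfolding inside_def append_Nil2
proof (rule comp_tree_step)
  show "1 + int (length ls) \<in> {0..<int B}" using assms(3) by simp
  show "moves par_ntm q (read_input x i) (tape (rev ls) (1 + int (length ls)))
      = {(q', 0, Stay, MoveLeft)}"
    using assms(1) by simp
  show "par_tree x B (Config q' (move Stay i)
      ((tape (rev ls))(1 + int (length ls) := 0)) (move MoveLeft (1 + int (length ls)))) m"
    using assms(2) unfolding left_of_def tape_upd by simp
qed

lemma home_halt:
  assumes "moves par_ntm q (read_input x i) 0 = {}" "B > 0" "m = (if q = Choose then 1 else 0)"
  shows "par_tree x B (home q i ps) m"
  unfolding home_def using assms by (intro comp_tree_halt) (simp_all add: par_ntm_def)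

lemma home_stay:
  assumes "moves par_ntm q (read_input x i) 0 = {(q', 0, d, Stay)}" "B > 0"
    and "par_tree x B (home q' (move d i) ps) m"
  shows "par_tree x B (home q i ps) m"
  unfolding home_def
  by (rule comp_tree_step[where q' = q' and s' = 0 and d = d and e = Stay])
    (use assms in \<open>simp_all add: home_def\<close>)

lemma home_right:
  assumes "moves par_ntm q (read_input x i) 0 = {(q', 0, d, MoveRight)}" "B > 0"
    and "par_tree x B (inside q' (move d i) [] ps) m"
  shows "par_tree x B (home q i ps) m"
  unfolding home_def
  by (rule comp_tree_step[where q' = q' and s' = 0 and d = d and e = MoveRight])
    (use assms in \<open>simp_all add: inside_def\<close>)

text \<open>A state that keeps moving left, rewriting each digit by \<open>g\<close>, reaches the home cell.\<close>

lemma sweep_left: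
  assumes "\<And>p. moves par_ntm q (read_input x i) (sym_of p) = {(q, sym_of (g p), Stay, MoveLeft)}"
    and "length ls < B"
    and "par_tree x B (home q i (map g (rev ls) @ rs)) m"
  shows "par_tree x B (left_of q i ls rs) m"
  using assms(2,3)
proof (induction ls arbitrary: rs)
  case Nil
  then show ?case by (simp add: left_of_simps)
next
  case (Cons p ls)
  show ?case unfolding left_of_simps
    by (rule inside_left[OF assms(1)]) (use Cons in auto)
qed

section \<open>Binary counters\<close>

abbreviation val :: "bool list \<Rightarrow> nat" where
  "val \<equiv> horner_sum of_bool 2"

text \<open>The cell contents when both counters have the digits \<open>bs\<close>. This is the case whenever an increment,
  a decrement of \<open>\<kappa>\<close> or a choice begins.\<close>

definition diag :: "bool list \<Rightarrow> (bool \<times> bool) list" where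
  "diag = map (\<lambda>b. (b, b))"

text \<open>Successor and predecessor on digit lists, least significant digit first. Only the successor may
  lengthen the list; the predecessor keeps leading zeros and is meaningful for positive values only.\<close>

fun inc :: "bool list \<Rightarrow> bool list" where
  "inc [] = [True]"
| "inc (False # bs) = True # bs"
| "inc (True # bs) = False # inc bs"

fun dec :: "bool list \<Rightarrow> bool list" where
  "dec [] = []"
| "dec (True # bs) = False # bs"
| "dec (False # bs) = True # dec bs"

lemma val_inc: "val (inc bs) = Suc (val bs)"
  by (induction bs rule: inc.induct) auto

lemma last_inc: "(bs \<noteq> [] \<Longrightarrow> last bs) \<Longrightarrow> last (inc bs)"
  by (induction bs rule: inc.induct) (auto split: if_splits elim: inc.elims)

lemma val_dec: "val bs > 0 \<Longrightarrow> val (dec bs) = val bs - 1"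
  by (induction bs rule: dec.induct) auto

lemma length_dec: "length (dec bs) = length bs"
  by (induction bs rule: dec.induct) auto

lemma power_length_le_val: "\<lbrakk>bs \<noteq> []; last bs\<rbrakk> \<Longrightarrow> 2 ^ length bs \<le> 2 * val bs"
  by (induction bs) (auto split: if_splits)

section \<open>Runs of the counter operations\<close>

text \<open>Each lemma derives the computation tree at the beginning of a run from the one at its end. Since
  the runs are deterministic, the number of accepting leaves does not change.\<close>

lemma run_inc:
  assumes "read_input x i = Letter True"
    and "length ls + length (inc bs) + 1 < B"
    and "par_tree x B (home IncBack i (rev ls @ diag (inc bs))) m"
  shows "par_tree x B (inside Inc i ls (diag bs)) m"
proof -
  have return: "par_tree x B (left_of IncBack i ls rs) m"
    if "par_tree x B (home IncBack i (rev ls @ rs)) m" "length ls < B" for ls rs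
    by (rule sweep_left[where g = id]) (use that assms(1) in \<open>auto simp: moves_sweep\<close>)
  show ?thesis using assms(2,3)
  proof (induction bs arbitrary: ls rule: inc.induct)
    case 1
    show ?case unfolding diag_def list.map
      by (rule inside_left_extend[of _ _ _ IncBack "(True, True)"])
        (use 1 assms(1) in \<open>auto simp: moves_sweep diag_def intro!: return\<close>)
  next
    case (2 bs)
    show ?case unfolding diag_def list.map
      by (rule inside_left[of _ _ _ _ IncBack "(True, True)"])
        (use 2 assms(1) in \<open>auto simp: moves_sweep diag_def intro!: return\<close>)
  next
    case (3 bs)
    show ?case unfolding diag_def list.map
      by (rule inside_right[of _ _ _ _ Inc "(False, False)"])
        (use 3 assms(1) in \<open>auto simp: moves_sweep diag_def\<close>)
  qed
qed

lemma run_restore: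
  assumes "read_input x i \<in> {LeftEnd, Letter True}" "length ls < B"
    and "par_tree x B (home Choose i (map (\<lambda>p. (fst p, fst p)) (rev ls) @ rs)) m"
  shows "par_tree x B (left_of Restore i ls rs) m"
proof (rule sweep_left)
  show "moves par_ntm Restore (read_input x i) (sym_of p)
      = {(Restore, sym_of (fst p, fst p), Stay, MoveLeft)}" for p
    using assms(1) by (rule moves_sweep)
  show "par_tree x B (home Restore i (map (\<lambda>p. (fst p, fst p)) (rev ls) @ rs)) m"
    by (rule home_stay[of _ _ _ Choose Stay]) (use assms in \<open>auto simp: moves_sweep\<close>)
qed (rule assms(2))

text \<open>A decrement of zero halts without accepting, so that it contributes no accepting leaf.\<close>

lemma run_dec:
  assumes "read_input x i = Letter True"
    and "length ls + length bs + 1 < B"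
    and "val bs > 0 \<Longrightarrow> par_tree x B (home Choose i (rev (diag ls) @ diag (dec bs))) m"
    and "val bs = 0 \<Longrightarrow> m = 0"
  shows "par_tree x B (inside Dec i (diag ls) (diag bs)) m"
  using assms(2-)
proof (induction bs arbitrary: ls rule: dec.induct)
  case 1
  then have "m = 0" by simp
  moreover have "par_tree x B (inside Dec i (diag ls) (diag [])) 0"
    unfolding diag_def list.map
    by (rule inside_halt) (use 1 assms(1) in \<open>auto simp: moves_sweep\<close>)
  ultimately show ?case by simp
next
  case (2 bs)
  show ?case unfolding diag_def list.map
    by (rule inside_left[of _ _ _ _ Restore "(False, False)"])
      (use 2 assms(1) in \<open>auto simp: moves_sweep diag_def rev_map o_def intro!: run_restore\<close>)
next
  case (3 bs)
  show ?case unfolding diag_def list.map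
    by (rule inside_right[of _ _ _ _ Dec "(True, True)"])
      (use 3(1)[of "True # ls"] 3(2-) assms(1) in \<open>auto simp: moves_sweep diag_def\<close>)
qed

text \<open>One pass of the subtraction loop. After a failed decrement both counters are equal again.\<close>

lemma run_sub_step:
  assumes "read_input x i \<in> {LeftEnd, Letter True}"
    and "length ls + length rs + 1 < B"
    and "val (map snd rs) > 0 \<Longrightarrow>
      par_tree x B (home SubBack i (rev ls @ zip (map fst rs) (dec (map snd rs)))) m"
    and "val (map snd rs) = 0 \<Longrightarrow> par_tree x B (home Choose i (diag (map fst (rev ls @ rs)))) m"
  shows "par_tree x B (inside Sub i ls rs) m"
  using assms(2-)
proof (induction rs arbitrary: ls)
  case Nil
  show ?case
    by (rule inside_left_end[of _ _ _ Restore])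
      (use Nil assms(1) in \<open>auto simp: moves_sweep diag_def o_def intro!: run_restore\<close>)
next
  case (Cons p rs)
  show ?case
  proof (cases "snd p")
    case True
    then obtain b where p: "p = (b, True)" by (cases p) auto
    have "par_tree x B (home SubBack i (map id (rev ls) @ (b, False) # rs)) m"
      using Cons.prems(2) by (simp add: p zip_map_fst_snd)
    then have "par_tree x B (left_of SubBack i ls ((b, False) # rs)) m"
      using Cons.prems(1) by (intro sweep_left[where g = id]) (simp_all add: moves_sweep[OF assms(1)])
    then show ?thesis unfolding p
      by (intro inside_left[OF moves_sweep(9)[OF assms(1)]]) (use Cons.prems(1) in simp_all)
  next
    case False
    then obtain b where p: "p = (b, False)" by (cases p) auto
    have "par_tree x B (inside Sub i ((b, True) # ls) rs) m"
      using Cons.prems unfolding p by (intro Cons.IH) simp_all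
    then show ?thesis unfolding p
      by (intro inside_right[OF moves_sweep(8)[OF assms(1)]]) (use Cons.prems(1) in simp_all)
  qed
qed

lemma read_input_unary:
  assumes "False \<notin> set x" "i \<le> length x"
  shows "read_input x (int i) = (if i = 0 then LeftEnd else Letter True)"
proof (cases "i = 0")
  case False
  then have "x ! (i - 1) \<in> set x" using assms(2) by (intro nth_mem) simp
  then have "x ! (i - 1)" using assms(1) by (metis (full_types))
  then show ?thesis using False assms(2) by (simp add: read_input_def nat_diff_distrib)
qed (simp add: read_input_def)

text \<open>The whole loop subtracts the value of the second counter from the input head position \<open>r\<close>, and
  contributes no accepting leaf if \<open>r\<close> is too small.\<close>

lemma run_sub:
  assumes x: "False \<notin> set x"
    and "r \<le> length x" "length ps + 1 < B"
    and "val (map snd ps) \<le> r \<Longrightarrow>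
      par_tree x B (home Choose (int (r - val (map snd ps))) (diag (map fst ps))) m"
    and "r < val (map snd ps) \<Longrightarrow> m = 0"
  shows "par_tree x B (inside Sub (int r) [] ps) m"
  using assms(2-)
proof (induction r arbitrary: ps)
  case 0
  have "par_tree x B (home SubBack 0 qs) 0" for qs
    by (rule home_halt) (use 0 read_input_unary[OF x, of 0] in \<open>auto simp: moves_home\<close>)
  then show ?case
    using 0 read_input_unary[OF x, of 0] by (intro run_sub_step) auto
next
  case (Suc r)
  let ?ps = "zip (map fst ps) (dec (map snd ps))"
  have ps: "map fst ?ps = map fst ps" "map snd ?ps = dec (map snd ps)"
    by (simp_all add: length_dec)
  have "par_tree x B (home SubBack (int (Suc r)) ?ps) m" if pos: "val (map snd ps) > 0"
  proof (rule home_right[of _ _ _ Sub MoveLeft])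
    have "par_tree x B (inside Sub (int r) [] ?ps) m"
      by (rule Suc.IH) (use Suc.prems pos in \<open>simp_all add: ps val_dec length_dec del: of_nat_diff\<close>)
    then show "par_tree x B (inside Sub (move MoveLeft (int (Suc r))) [] ?ps) m" by simp
  qed (use Suc.prems read_input_unary[OF x, of "Suc r"] in \<open>auto simp: moves_home\<close>)
  then show ?case
    using Suc.prems read_input_unary[OF x, of "Suc r"] by (intro run_sub_step) auto
qed

section \<open>Counting the accepting paths\<close>

text \<open>The two options of \<open>Choose\<close> are the two terms of the recurrence. Termination is due to the
  decrease of \<open>\<kappa> + r\<close>.\<close>

lemma run_choose:
  assumes x: "False \<notin> set x" and "r \<le> length x" "length bs + 1 < B"
  shows "par_tree x B (home Choose (int r) (diag bs)) (card (bounded_parts (Suc (val bs)) r))"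
  using assms(2-)
proof (induction "val bs + r" arbitrary: bs r rule: less_induct)
  case less
  show ?case
  proof (cases "r = 0")
    case True
    show ?thesis
      by (rule home_halt) (use True less.prems read_input_unary[OF x, of 0] in
        \<open>auto simp: moves_home bounded_parts_0_right\<close>)
  next
    case False
    let ?m = "if Suc (val bs) \<le> r then card (bounded_parts (Suc (val bs)) (r - Suc (val bs))) else 0"
    have read: "read_input x (int r) = Letter True"
      using read_input_unary[OF x less.prems(1)] False by simp
    have dec: "par_tree x B (inside Dec (int r) (diag []) (diag bs)) (card (bounded_parts (val bs) r))"
    proof (rule run_dec)
      assume "val bs > 0"
      then show "par_tree x B (home Choose (int r) (rev (diag []) @ diag (dec bs)))
          (card (bounded_parts (val bs) r))"
        using less.hyps[of "dec bs" r] less.prems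
        by (simp add: val_dec length_dec diag_def)
    qed (use False less.prems read in \<open>auto simp: bounded_parts_0_left\<close>)
    have [simp]: "map fst (diag bs) = bs" "map snd (diag bs) = bs" "length (diag bs) = length bs"
      by (simp_all add: diag_def o_def)
    have sub: "par_tree x B (inside Sub (int (r - 1)) [] (diag bs)) ?m"
    proof (rule run_sub[OF x])
      assume "val (map snd (diag bs)) \<le> r - 1"
      then show "par_tree x B (home Choose (int (r - 1 - val (map snd (diag bs)))) (diag (map fst (diag bs)))) ?m"
        using less.hyps[of bs "r - Suc (val bs)"] less.prems False by (auto simp del: of_nat_diff)
    qed (use less.prems in auto)
    have "par_tree x B (home Choose (int r) (diag bs)) (card (bounded_parts (val bs) r) + ?m)"
      unfolding home_def
      by (rule comp_tree_choice[of _ _ _ _ _ _ _ Dec 0 Stay MoveRight Sub 0 MoveLeft MoveRight])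
        (use dec sub less.prems read False in \<open>auto simp: moves_home inside_def diag_def\<close>)
    then show ?thesis by (simp add: card_bounded_parts_Suc)
  qed
qed

text \<open>A bound on the cells visited on inputs of length \<open>n\<close>. For \<open>n > 0\<close> there are at most
  \<open>\<lfloor>log 2 n\<rfloor> + 1\<close> digits, the home cell and the blank after the digits.\<close>

definition cells :: "nat \<Rightarrow> nat" where
  "cells n = nat \<lfloor>log 2 (real n)\<rfloor> + 3"

lemma cells_pos: "cells n > 0"
  by (simp add: cells_def)

lemma length_digits_less_cells:
  assumes "bs \<noteq> [] \<Longrightarrow> last bs" "val bs \<le> n"
  shows "length bs + 1 < cells n"
proof (cases bs)
  case (Cons b bs')
  then have "2 ^ length bs \<le> 2 * val bs"
    using assms(1) by (intro power_length_le_val) simp_all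
  also have "\<dots> \<le> 2 * n" using assms(2) by simp
  finally have "2 ^ length bs \<le> 2 * n" .
  then have "2 ^ length bs' \<le> n" using Cons by simp
  then have "real (length bs') \<le> log 2 (real n)" by (rule le_log2_of_power)
  then have "int (length bs') \<le> \<lfloor>log 2 (real n)\<rfloor>" by (simp add: le_floor_iff)
  then show ?thesis using Cons by (simp add: cells_def)
qed (simp add: cells_def)

lemma cells_bigo: "(\<lambda>n. real (cells n)) \<in> O(\<lambda>n. ln (real n))"
proof (rule bigoI[where c = "4 / ln 2"], rule eventually_at_top_linorderI)
  fix n :: nat
  assume "n \<ge> 2"
  then have "1 \<le> log 2 (real n)" by simp
  then have "real (cells n) \<le> log 2 (real n) + 3"
    unfolding cells_def by simp
  also have "\<dots> \<le> 4 * log 2 (real n)" using \<open>1 \<le> log 2 (real n)\<close> by simp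
  finally show "norm (real (cells n)) \<le> 4 / ln 2 * norm (ln (real n))"
    using \<open>n \<ge> 2\<close> by (simp add: log_def)
qed

text \<open>The counters hold the number of letters read so far, without leading zeros (the last digit, if any,
  is 1); this is what bounds the number of digits. At the end \<open>\<kappa> = n\<close>, and parts of size at
  most \<open>n + 1\<close> are no restriction for partitions of \<open>n\<close>.\<close>

lemma run_scan:
  assumes "val bs \<le> length x" "False \<notin> set (take (val bs) x)" "bs \<noteq> [] \<Longrightarrow> last bs"
  shows "par_tree x (cells (length x)) (home Scan (1 + int (val bs)) (diag bs))
    (if False \<notin> set x then card (Par (length x)) else 0)"
  using assms
proof (induction "length x - val bs" arbitrary: bs)
  case 0
  then have x: "False \<notin> set x" "val bs = length x" by auto
  have B: "length bs + 1 < cells (length x)"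
    by (rule length_digits_less_cells) (use 0 x(2) in auto)
  have "par_tree x (cells (length x)) (home Scan (1 + int (val bs)) (diag bs))
      (card (bounded_parts (Suc (val bs)) (length x)))"
  proof (rule home_stay[of _ _ _ Choose MoveLeft])
    show "moves par_ntm Scan (read_input x (1 + int (val bs))) 0 = {(Choose, 0, MoveLeft, Stay)}"
      using x(2) by (simp add: moves_home read_input_def)
    show "par_tree x (cells (length x)) (home Choose (move MoveLeft (1 + int (val bs))) (diag bs))
        (card (bounded_parts (Suc (val bs)) (length x)))"
      using run_choose[OF x(1) order_refl B] x(2) by simp
  qed (rule cells_pos)
  then show ?case using x by (simp add: bounded_parts_eq_Par)
next
  case (Suc d)
  let ?i = "1 + int (val bs)"
  have less: "val bs < length x" using Suc by simp
  then have read: "read_input x ?i = Letter (x ! val bs)" by (simp add: read_input_def)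
  show ?case
  proof (cases "x ! val bs")
    case False
    then have "False \<in> set x" using less by (metis (full_types) nth_mem)
    moreover have "par_tree x (cells (length x)) (home Scan ?i (diag bs)) 0"
      by (rule home_halt) (use False read in \<open>simp_all add: moves_home cells_pos\<close>)
    ultimately show ?thesis by simp
  next
    case True
    let ?m = "if False \<notin> set x then card (Par (length x)) else 0"
    have last: "inc bs \<noteq> [] \<Longrightarrow> last (inc bs)"
      using Suc.prems(3) by (intro last_inc)
    have length: "length (inc bs) + 1 < cells (length x)"
      by (rule length_digits_less_cells[OF last]) (use less in \<open>simp_all add: val_inc\<close>)
    have "par_tree x (cells (length x)) (home Scan (1 + int (val (inc bs))) (diag (inc bs))) ?m"
    proof (rule Suc.hyps(1))
      show "d = length x - val (inc bs)" using Suc.hyps(2) by (simp add: val_inc)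
      show "val (inc bs) \<le> length x" using less by (simp add: val_inc)
      show "False \<notin> set (take (val (inc bs)) x)"
        using Suc.prems(2) less True by (simp add: val_inc take_Suc_conv_app_nth)
    qed (rule last)
    then have scan: "par_tree x (cells (length x)) (home Scan (move MoveRight ?i) (diag (inc bs))) ?m"
      by (simp add: val_inc add_ac)
    have "par_tree x (cells (length x)) (home IncBack ?i (rev [] @ diag (inc bs))) ?m"
      unfolding rev.simps append_Nil
      by (rule home_stay[OF _ cells_pos scan]) (simp add: read True moves_home)
    then have "par_tree x (cells (length x)) (inside Inc (move Stay ?i) [] (diag bs)) ?m"
      unfolding move.simps using length by (intro run_inc) (simp_all add: read True)
    then show ?thesis
      by (rule home_right[OF _ cells_pos, rotated]) (simp add: read True moves_home)
  qed
qed

theorem theorem5p1: "on_unary (\<lambda>n. card (Par n)) \<in> sharpL"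
proof (rule sharpL_I[OF wf_par_ntm cells_bigo])
  fix x
  have "x = replicate (length x) True \<longleftrightarrow> False \<notin> set x"
    using replicate_length_same[of x True] by (metis (full_types) in_set_replicate)
  then have f: "on_unary (\<lambda>n. card (Par n)) x = (if False \<notin> set x then card (Par (length x)) else 0)"
    by (simp add: on_unary_def)
  have "tape [] = (\<lambda>_. 0)" by (auto simp: tape_def)
  then have "init_config par_ntm = home Scan 0 (diag [])"
    by (simp add: init_config_def home_def diag_def par_ntm_def)
  moreover have "par_tree x (cells (length x)) (home Scan 0 (diag []))
      (if False \<notin> set x then card (Par (length x)) else 0)"
  proof (rule home_stay[of _ _ _ Scan MoveRight])
    show "moves par_ntm Scan (read_input x 0) 0 = {(Scan, 0, MoveRight, Stay)}"
      by (simp add: moves_home read_input_def)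
    show "par_tree x (cells (length x)) (home Scan (move MoveRight 0) (diag []))
        (if False \<notin> set x then card (Par (length x)) else 0)"
      using run_scan[of "[]" x] by simp
  qed (rule cells_pos)
  ultimately show "par_tree x (cells (length x)) (init_config par_ntm)
      (on_unary (\<lambda>n. card (Par n)) x)"
    using f by simp
qed

end
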